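(* Let $n\ge 1$, $K>1$, let $\mathcal{Z}$ be the finite set of partitions of $n$ items, let $c:\mathcal{Z}\times\mathcal{Z}\to\mathbb{R}_+$ be a metric on $\mathcal{Z}$, and let $\zeta_1,\dots,\zeta_K>0$. Let $X=(X^{(1)},\dots,X^{(K)})$ be fixed observed data with likelihoods $p_k(X^{(k)}\mid \mathbf{z}^{(k)})$, $\mathbf{z}^{(k)}\in\mathcal{Z}$, $k=1,\dots,K$, and let $p(\mathbf{z},\mathbf{z}^{(1)},\dots,\mathbf{z}^{(K)},X)$ be the joint distribution of the hierarchical model $$p(\mathbf{z},\mathbf{z}^{(1)},\dots,\mathbf{z}^{(K)},X)=p(\mathbf{z})\prod_{k=1}^K p(\mathbf{z}^{(k)}\mid\mathbf{z})\,p_k(X^{(k)}\mid\mathbf{z}^{(k)}),$$ where $$p(\mathbf{z}^{(k)}\mid \mathbf{z})=\frac{\exp[-\zeta_k c(\mathbf{z}^{(k)},\mathbf{z})]}{C_k(\mathbf{z})},\qquad C_k(\mathbf{z})=\sum_{\mathbf{z}^{(k)}\in\mathcal{Z}}\exp[-\zeta_k c(\mathbf{z}^{(k)},\mathbf{z})],\qquad p(\mathbf{z})\propto\prod_{k=1}^K C_k(\mathbf{z}).$$ For a probability measure $q$ on $\mathcal{Z}^{K+1}$ define the negative evidence lower bound $$\mathcal{L}(q)=\mathbb{E}_{(\mathbf{z},\mathbf{z}^{(1)},\dots,\mathbf{z}^{(K)})\sim q}\left[-\log p(\mathbf{z},\mathbf{z}^{(1)},\dots,\mathbf{z}^{(K)},X)\right]-H_q(\mathbf{z},\mathbf{z}^{(1)},\dots,\mathbf{z}^{(K)}).$$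 Then for all probability measures $q_0,q_1,\dots,q_K$ on $\mathcal{Z}$, $$\min_{q\in\Pi(q_0,q_1,\dots,q_K)}\mathcal{L}(q)\;\le\;\sum_{k=1}^K\zeta_k\,W_{c,\frac{1}{K\zeta_k}}(q_0,q_k)-\sum_{k=1}^K\mathbb{E}_{\mathbf{z}^{(k)}\sim q_k}\left[\log p_k(X^{(k)}\mid\mathbf{z}^{(k)})\right]+C,$$ where $C=\sum_{\mathbf{z}\in\mathcal{Z}}\prod_{k=1}^K C_k(\mathbf{z})>0$ is a constant (not depending on $q_0,\dots,q_K$).
   Context: $\Pi(q_0,q_1,\dots,q_K)$ is the set of joint probability measures (couplings) of $(\mathbf{z},\mathbf{z}^{(1)},\dots,\mathbf{z}^{(K)})$ on $\mathcal{Z}^{K+1}$ whose marginals are $q_0,q_1,\dots,q_K$ respectively (so $\mathbf{z}\sim q_0$ and $\mathbf{z}^{(k)}\sim q_k$); $\Pi(q_0,q_k)$ is the analogous set of couplings on $\mathcal{Z}^2$. $H_q$ denotes the Shannon entropy of a discrete distribution, $H_q(\cdot)=-\sum q\log q$ (natural logarithm, $0\log 0=0$). For $\epsilon>0$ and probability measures $p_1,p_2$ on $\mathcal{Z}$, the entropic regularized Wasserstein cost is $$W_{c,\epsilon}(p_1,p_2)=\min_{\pi\in\Pi(p_1,p_2)}\left\{\sum_{\mathbf{z}_1\in\mathcal{Z}}\sum_{\mathbf{z}_2\in\mathcal{Z}}c(\mathbf{z}_1,\mathbf{z}_2)\,\pi(\mathbf{z}_1,\mathbf{z}_2)-\epsilon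 H_\pi(\mathbf{z}_1,\mathbf{z}_2)\right\}.$$ The likelihood values $p_k(X^{(k)}\mid\mathbf{z}^{(k)})$ are fixed numbers in $[0,\infty)$ (the data being fixed), with the conventions $-\log 0=+\infty$ and $0\cdot\infty=0$ in expectations. The distribution $p(\mathbf{z})$ is normalized to be a probability measure on $\mathcal{Z}$. *)

theory Defs
  imports "HOL-Probability.Probability"
begin

definition item_partitions :: "nat \<Rightarrow> nat set set set" where
  "item_partitions n = {P. partition_on {1..n} P}"

text \<open>
  Minimum of \<open>f\<close> over a possibly infinite set, for which \<open>Min\<close> is unavailable. The value is
  meaningful only when the minimum is attained.
\<close>
definition min_over :: "'a set \<Rightarrow> ('a \<Rightarrow> 'b::linorder) \<Rightarrow> 'b" where
  "min_over S f = (LEAST v. v \<in> f ` S)"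

text \<open>Logarithm on \<open>[0,\<infinity>)\<close> with \<open>log 0 = -\<infinity>\<close>; the library \<open>ln\<close> has \<open>ln 0 = 0\<close>.\<close>
definition elog :: "real \<Rightarrow> ereal" where
  "elog x = (if x = 0 then -\<infinity> else ereal (ln x))"

text \<open>Expectation over a finite set carrying \<open>q\<close>; on \<open>ereal\<close>, \<open>0 * \<infinity> = 0\<close>.\<close>
definition expect_on :: "'a set \<Rightarrow> 'a pmf \<Rightarrow> ('a \<Rightarrow> ereal) \<Rightarrow> ereal" where
  "expect_on A q f = (\<Sum>x\<in>A. ereal (pmf q x) * f x)"

text \<open>For finitely supported \<open>q\<close>; summing over the support only realises \<open>0 log 0 = 0\<close>.\<close>
definition shannon_entropy :: "'a pmf \<Rightarrow> real" where
  "shannon_entropy q = - (\<Sum>x\<in>set_pmf q. pmf q x * ln (pmf q x))"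

definition couplings :: "'a pmf \<Rightarrow> 'a pmf \<Rightarrow> ('a \<times> 'a) pmf set" where
  "couplings p1 p2 = {\<pi>. map_pmf fst \<pi> = p1 \<and> map_pmf snd \<pi> = p2}"

definition entropic_cost :: "'a set \<Rightarrow> ('a \<Rightarrow> 'a \<Rightarrow> real) \<Rightarrow> real \<Rightarrow> 'a pmf \<Rightarrow> 'a pmf \<Rightarrow> real" where
  "entropic_cost Z c \<epsilon> p1 p2 = min_over (couplings p1 p2)
     (\<lambda>\<pi>. (\<Sum>z1\<in>Z. \<Sum>z2\<in>Z. c z1 z2 * pmf \<pi> (z1, z2)) - \<epsilon> * shannon_entropy \<pi>)"

text \<open>
  A point \<open>(z, z\<^sup>(\<^sup>1\<^sup>), \<dots>, z\<^sup>(\<^sup>K\<^sup>))\<close> of \<open>Z\<^sup>K\<^sup>+\<^sup>1\<close> is an extensional function \<open>x\<close> on \<open>{0..K}\<close>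
  with \<open>x 0 = z\<close> and \<open>x k = z\<^sup>(\<^sup>k\<^sup>)\<close>.
\<close>
definition tuples :: "'a set \<Rightarrow> nat \<Rightarrow> (nat \<Rightarrow> 'a) set" where
  "tuples Z K = (\<Pi>\<^sub>E k\<in>{0..K}. Z)"

definition multi_couplings :: "'a set \<Rightarrow> nat \<Rightarrow> (nat \<Rightarrow> 'a pmf) \<Rightarrow> (nat \<Rightarrow> 'a) pmf set" where
  "multi_couplings Z K qs =
     {q. set_pmf q \<subseteq> tuples Z K \<and> (\<forall>k\<in>{0..K}. map_pmf (\<lambda>x. x k) q = qs k)}"

definition local_norm :: "'a set \<Rightarrow> ('a \<Rightarrow> 'a \<Rightarrow> real) \<Rightarrow> real \<Rightarrow> 'a \<Rightarrow> real" where
  "local_norm Z c \<zeta> z = (\<Sum>z'\<in>Z. exp (- \<zeta> * c z' z))"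

text \<open>\<open>local_prob Z c \<zeta>\<^sub>k z' z\<close> is \<open>p(z\<^sup>(\<^sup>k\<^sup>) = z' | z)\<close>.\<close>
definition local_prob :: "'a set \<Rightarrow> ('a \<Rightarrow> 'a \<Rightarrow> real) \<Rightarrow> real \<Rightarrow> 'a \<Rightarrow> 'a \<Rightarrow> real" where
  "local_prob Z c \<zeta> z' z = exp (- \<zeta> * c z' z) / local_norm Z c \<zeta> z"

definition prior_norm :: "'a set \<Rightarrow> ('a \<Rightarrow> 'a \<Rightarrow> real) \<Rightarrow> (nat \<Rightarrow> real) \<Rightarrow> nat \<Rightarrow> real" where
  "prior_norm Z c \<zeta> K = (\<Sum>z\<in>Z. \<Prod>k=1..K. local_norm Z c (\<zeta> k) z)"

definition prior :: "'a set \<Rightarrow> ('a \<Rightarrow> 'a \<Rightarrow> real) \<Rightarrow> (nat \<Rightarrow> real) \<Rightarrow> nat \<Rightarrow> 'a \<Rightarrow> real" where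
  "prior Z c \<zeta> K z = (\<Prod>k=1..K. local_norm Z c (\<zeta> k) z) / prior_norm Z c \<zeta> K"

text \<open>\<open>lik k z\<close> stands for \<open>p\<^sub>k(X\<^sup>(\<^sup>k\<^sup>) | z\<^sup>(\<^sup>k\<^sup>) = z)\<close> at the fixed data \<open>X\<close>.\<close>
definition joint ::
  "'a set \<Rightarrow> ('a \<Rightarrow> 'a \<Rightarrow> real) \<Rightarrow> (nat \<Rightarrow> real) \<Rightarrow> nat \<Rightarrow> (nat \<Rightarrow> 'a \<Rightarrow> real) \<Rightarrow> (nat \<Rightarrow> 'a) \<Rightarrow> real"
where
  "joint Z c \<zeta> K lik x =
     prior Z c \<zeta> K (x 0) * (\<Prod>k=1..K. local_prob Z c (\<zeta> k) (x k) (x 0) * lik k (x k))"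

definition neg_elbo ::
  "'a set \<Rightarrow> ('a \<Rightarrow> 'a \<Rightarrow> real) \<Rightarrow> (nat \<Rightarrow> real) \<Rightarrow> nat \<Rightarrow> (nat \<Rightarrow> 'a \<Rightarrow> real) \<Rightarrow> (nat \<Rightarrow> 'a) pmf \<Rightarrow> ereal"
where
  "neg_elbo Z c \<zeta> K lik q =
     expect_on (tuples Z K) q (\<lambda>x. - elog (joint Z c \<zeta> K lik x)) - ereal (shannon_entropy q)"

end

theory Submission
  imports Defs
begin

text \<open>
  The kernel normalisers cancel against the prior, so with \<open>S = prior_norm Z c \<zeta> K\<close> the negative
  ELBO of a coupling \<open>q\<close> is \<open>ln S\<close> plus expected transport costs, minus expected log-likelihoods,
  minus the entropy of \<open>q\<close>. Optimal two-marginal couplings \<open>\<pi>\<^sub>k\<close> of \<open>(q\<^sub>0, q\<^sub>k)\<close> share the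
  marginal \<open>q\<^sub>0\<close> and can be glued to one coupling \<open>q\<close>. Each \<open>\<pi>\<^sub>k\<close> is then a marginal of \<open>q\<close>, so
  \<open>H(q) \<ge> H(\<pi>\<^sub>k)\<close>, and averaging over \<open>k\<close> gives the bound with constant \<open>ln S \<le> S\<close>. If some
  likelihood vanishes on the support of \<open>q\<^sub>k\<close>, both sides are \<open>\<infinity>\<close>. All minima are attained because
  sets of couplings on finite sets are compact.
\<close>

section \<open>Entropy and images of finitely supported distributions\<close>

text \<open>Only \<open>t = 0\<close> is delicate: there the product is 0, which is also the limit
  from the right. Entropy is thereby continuous up to the boundary of the simplex.\<close>

lemma continuous_on_mult_ln: "continuous_on {0..} (\<lambda>t::real. t * ln t)"
  unfolding continuous_on_def
proof
  fix t :: real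
  assume "t \<in> {0..}"
  show "((\<lambda>t. t * ln t) \<longlongrightarrow> t * ln t) (at t within {0..})"
  proof (cases "t = 0")
    case True
    have "((\<lambda>t::real. t * ln t) \<longlongrightarrow> 0) (at_right 0)"
      by real_asymp
    moreover have "at (0::real) within {0..} = at_right 0"
      by (metis at_within_Ici_at_right)
    ultimately show ?thesis
      using True by simp
  next
    case False
    then show ?thesis
      by (intro tendsto_intros) auto
  qed
qed

text \<open>Change of variables: both sums are the expectation of \<open>g (f x)\<close> under
  \<open>q\<close>, since points outside the supports have weight 0.\<close>

lemma sum_pmf_map_pmf:
  fixes g :: "'b \<Rightarrow> real"
  assumes "finite A" "finite B" "set_pmf q \<subseteq> A" "set_pmf (map_pmf f q) \<subseteq> B"
  shows "(\<Sum>y\<in>B. g y * pmf (map_pmf f q) y) = (\<Sum>x\<in>A. g (f x) * pmf q x)"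
proof -
  have "(\<Sum>y\<in>B. g y * pmf (map_pmf f q) y) = measure_pmf.expectation (map_pmf f q) g"
    using assms by (intro integral_measure_pmf_real[symmetric]) auto
  also have "\<dots> = measure_pmf.expectation q (\<lambda>x. g (f x))"
    by simp
  also have "\<dots> = (\<Sum>x\<in>A. g (f x) * pmf q x)"
    using assms by (intro integral_measure_pmf_real) auto
  finally show ?thesis .
qed

text \<open>The support varies with \<open>q\<close>; summing over a fixed \<open>A\<close> makes
  entropy a continuous function of the point masses.\<close>

lemma shannon_entropy_eq_sum:
  assumes "finite A" "set_pmf q \<subseteq> A"
  shows "shannon_entropy q = - (\<Sum>x\<in>A. pmf q x * ln (pmf q x))"
  unfolding shannon_entropy_def
  using assms by (intro arg_cong[of _ _ uminus] sum.mono_neutral_left) (auto simp: set_pmf_iff)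

lemma pmf_le_pmf_map: "pmf q x \<le> pmf (map_pmf f q) (f x)"
proof -
  have "measure q {x} \<le> measure q (f -` {f x})"
    by (intro measure_pmf.finite_measure_mono) auto
  then show ?thesis
    by (simp add: pmf_map pmf.rep_eq)
qed

text \<open>Each point has at most the mass of its fibre under \<open>f\<close>. Taking logarithms
  and averaging over \<open>q\<close> compares the two entropies.\<close>

lemma shannon_entropy_map_pmf_le:
  assumes "finite (set_pmf q)"
  shows "shannon_entropy (map_pmf f q) \<le> shannon_entropy q"
proof -
  let ?p = "map_pmf f q"
  have "(\<Sum>x\<in>set_pmf q. ln (pmf q x) * pmf q x) \<le> (\<Sum>x\<in>set_pmf q. ln (pmf ?p (f x)) * pmf q x)"
    by (intro sum_mono mult_right_mono ln_mono pmf_le_pmf_map) (auto simp: pmf_positive)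
  also have "\<dots> = (\<Sum>y\<in>set_pmf ?p. ln (pmf ?p y) * pmf ?p y)"
    using assms by (intro sum_pmf_map_pmf[symmetric]) auto
  finally show ?thesis
    by (simp add: shannon_entropy_def mult.commute)
qed

text \<open>Turns a marginal condition into linear equations in the point masses, each involving
  finitely many coordinates, so that it is closed.\<close>

lemma map_pmf_eq_iff_sum:
  assumes "finite A" "set_pmf q \<subseteq> A"
  shows "map_pmf f q = p \<longleftrightarrow> (\<forall>y. (\<Sum>x\<in>A \<inter> f -` {y}. pmf q x) = pmf p y)"
proof -
  have "pmf (map_pmf f q) y = (\<Sum>x\<in>A \<inter> f -` {y}. pmf q x)" for y
  proof -
    have "measure q (f -` {y}) = measure q (A \<inter> f -` {y})"
      using assms by (intro measure_pmf.finite_measure_eq_AE) (auto simp: AE_measure_pmf_iff)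
    then show ?thesis
      using assms by (simp add: pmf_map measure_measure_pmf_finite)
  qed
  then show ?thesis
    by (auto simp: pmf_eq_iff)
qed

lemma ex_pmf_eq:
  assumes "finite A" "\<And>x. x \<in> A \<Longrightarrow> 0 \<le> h x" "\<And>x. x \<notin> A \<Longrightarrow> h x = 0" "sum h A = 1"
  obtains q where "pmf q = h" "set_pmf q \<subseteq> A"
proof -
  have nonneg: "0 \<le> h x" for x
    using assms(2,3) by (cases "x \<in> A") auto
  have "(\<integral>\<^sup>+x. ennreal (h x) \<partial>count_space UNIV) = (\<Sum>x\<in>A. ennreal (h x))"
    using assms by (intro nn_integral_count_space') auto
  also have "\<dots> = 1"
    using nonneg assms(4) by simp
  finally have "pmf (embed_pmf h) x = h x" for x
    using nonneg by (intro pmf_embed_pmf)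
  then show thesis
    using assms(3) by (intro that[of "embed_pmf h"]) (auto simp: set_pmf_eq)
qed

section \<open>Compactness under prescribed marginals\<close>

text \<open>A common form for \<open>couplings\<close> and \<open>multi_couplings\<close>, so that
  one compactness argument serves both. A pair in \<open>M\<close> is a map and the law its image
  must have.\<close>

definition marginal_pmfs :: "'a set \<Rightarrow> (('a \<Rightarrow> 'b) \<times> 'b pmf) set \<Rightarrow> 'a pmf set" where
  "marginal_pmfs A M = {q. set_pmf q \<subseteq> A \<and> (\<forall>(f, p)\<in>M. map_pmf f q = p)}"

text \<open>
  Fixing marginals imposes closed (linear) conditions on a product of compact intervals.
\<close>
lemma compact_marginal_pmfs:
  assumes "finite A"
  shows "compact (pmf ` marginal_pmfs A M)"
proof -
  \<comment> \<open>Functions live on the whole type, so coordinates outside \<open>A\<close> are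
    pinned to 0. Total mass 1 is imposed in \<open>C\<close>, since \<open>M\<close> may be
    empty.\<close>
  define B where "B = (\<Pi>\<^sub>E x\<in>UNIV. if x \<in> A then {0..1::real} else {0})"
  define C where "C = {h. sum h A = (1::real)} \<inter>
    (\<Inter>(f, p)\<in>M. \<Inter>y. {h. (\<Sum>x\<in>A \<inter> f -` {y}. h x) = pmf p y})"
  have sum_cont: "continuous_on UNIV (\<lambda>h::'a \<Rightarrow> real. sum h S)" for S
    by (intro continuous_intros continuous_on_product_coordinates)
  have "compactin (product_topology (\<lambda>_. euclidean) UNIV) B"
    unfolding B_def compactin_PiE by auto
  then have "compact B"
    by (simp add: euclidean_product_topology)
  moreover have "closed C"
    unfolding C_def
    by (intro closed_Int closed_INT ballI)
       (auto intro!: closed_INT closed_Collect_eq sum_cont continuous_on_const)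
  ultimately have "compact (B \<inter> C)"
    by (rule compact_Int_closed)
  moreover have "pmf ` marginal_pmfs A M = B \<inter> C"
  proof (intro equalityI subsetI)
    fix h
    assume "h \<in> pmf ` marginal_pmfs A M"
    then obtain q where q: "h = pmf q" "set_pmf q \<subseteq> A" "\<forall>(f, p)\<in>M. map_pmf f q = p"
      by (auto simp: marginal_pmfs_def)
    have "(\<Sum>x\<in>A \<inter> f -` {y}. pmf q x) = pmf p y" if "(f, p) \<in> M" for f p y
      using q(3) that map_pmf_eq_iff_sum[OF assms q(2), of f p] by auto
    moreover have "pmf q x = 0" if "x \<notin> A" for x
      using q(2) that by (auto simp: set_pmf_eq)
    ultimately show "h \<in> B \<inter> C"
      using sum_pmf_eq_1[OF assms q(2)] by (auto simp: q(1) B_def C_def pmf_le_1)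
  next
    fix h
    assume h: "h \<in> B \<inter> C"
    have "h x \<in> (if x \<in> A then {0..1} else {0})" for x
      using h by (auto simp: B_def PiE_iff)
    then have "\<And>x. x \<in> A \<Longrightarrow> 0 \<le> h x" "\<And>x. x \<notin> A \<Longrightarrow> h x = 0"
      by (metis atLeastAtMost_iff singletonD)+
    moreover have "sum h A = 1"
      using h by (simp add: C_def)
    ultimately obtain q where q: "pmf q = h" "set_pmf q \<subseteq> A"
      using assms ex_pmf_eq by metis
    moreover have "map_pmf f q = p" if "(f, p) \<in> M" for f p
      using h that unfolding map_pmf_eq_iff_sum[OF assms q(2)] q by (auto simp: C_def)
    ultimately show "h \<in> pmf ` marginal_pmfs A M"
      by (auto simp: marginal_pmfs_def)
  qed
  ultimately show ?thesis
    by simp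
qed

text \<open>The objective is a continuous function of the point masses, and these range over a
  compact set. Transport costs and the negative ELBO are both of this form.\<close>

lemma marginal_pmfs_attains_min:
  assumes "finite A" "marginal_pmfs A M \<noteq> {}"
  obtains q where "q \<in> marginal_pmfs A M"
    "\<And>q'. q' \<in> marginal_pmfs A M \<Longrightarrow>
      (\<Sum>x\<in>A. g x * pmf q x) - \<epsilon> * shannon_entropy q
      \<le> (\<Sum>x\<in>A. g x * pmf q' x) - \<epsilon> * shannon_entropy q'"
proof -
  define F where "F h = (\<Sum>x\<in>A. g x * h x) + \<epsilon> * (\<Sum>x\<in>A. h x * ln (h x))" for h :: "'a \<Rightarrow> real"
  let ?P = "pmf ` marginal_pmfs A M"
  have coord: "continuous_on ?P (\<lambda>h. h x)" for x :: 'a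
    by (rule continuous_on_subset[OF continuous_on_product_coordinates]) auto
  have mult_ln: "continuous_on ?P (\<lambda>h. h x * ln (h x))" for x
    by (rule continuous_on_compose2[OF continuous_on_mult_ln coord]) auto
  have "continuous_on ?P F"
    unfolding F_def by (intro continuous_on_add continuous_on_sum continuous_on_mult_left coord mult_ln)
  from continuous_attains_inf[OF compact_marginal_pmfs[OF assms(1)] _ this] assms(2)
  obtain q where q: "q \<in> marginal_pmfs A M"
    "\<And>q'. q' \<in> marginal_pmfs A M \<Longrightarrow> F (pmf q) \<le> F (pmf q')"
    by auto
  have "F (pmf q') = (\<Sum>x\<in>A. g x * pmf q' x) - \<epsilon> * shannon_entropy q'"
    if "q' \<in> marginal_pmfs A M" for q'
    using that assms by (simp add: F_def marginal_pmfs_def shannon_entropy_eq_sum)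
  with q show thesis
    by (intro that[of q]) auto
qed

section \<open>Gluing couplings along a shared marginal\<close>

text \<open>Draw \<open>z\<close> from \<open>p\<close>; given \<open>z\<close>, draw the other
  coordinates independently, the \<open>k\<close>-th from the second component of
  \<open>\<pi> k\<close> conditioned on first component \<open>z\<close>.\<close>

lemma glue_couplings:
  assumes "\<And>k. k \<in> {1..K} \<Longrightarrow> map_pmf fst (\<pi> k) = p"
  obtains q :: "(nat \<Rightarrow> 'a) pmf" where "set_pmf q \<subseteq> extensional {0..K}" "map_pmf (\<lambda>x. x 0) q = p"
    "\<And>k. k \<in> {1..K} \<Longrightarrow> map_pmf (\<lambda>x. (x 0, x k)) q = \<pi> k"
proof -
  \<comment> \<open>\<open>D z\<close> is the conditional law of the tuple given \<open>z\<close>.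
    The default \<open>undefined\<close> outside \<open>{0..K}\<close> makes its samples
    extensional.\<close>
  define D where "D z = Pi_pmf {0..K} undefined
    (\<lambda>k. if k = 0 then return_pmf z else map_pmf snd (cond_pmf (\<pi> k) {y. fst y = z}))" for z
  define q where "q = bind_pmf p D"
  have D_ext: "set_pmf (D z) \<subseteq> extensional {0..K}" for z
    unfolding D_def by (rule order.trans[OF set_Pi_pmf_subset]) (auto simp: extensional_def)
  have D_0: "map_pmf (\<lambda>x. x 0) (D z) = return_pmf z" for z
    unfolding D_def by (subst Pi_pmf_component) auto
  have D_eq: "x 0 = z" if "x \<in> set_pmf (D z)" for x z
    using imageI[OF that, of "\<lambda>x. x 0"] unfolding set_map_pmf[symmetric] D_0 by simp
  have "map_pmf (\<lambda>x. (x 0, x k)) q = \<pi> k" if k: "k \<in> {1..K}" for k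
  proof -
    \<comment> \<open>\<open>cond_pmf\<close> is meaningful only if the event meets the support,
      which holds for every \<open>z\<close> that \<open>p\<close> can produce.\<close>
    have nonempty: "set_pmf (\<pi> k) \<inter> {y. fst y = z} \<noteq> {}" if "z \<in> set_pmf p" for z
      using that unfolding assms[OF k, symmetric] by auto
    have "map_pmf (\<lambda>x. (x 0, x k)) (D z) = cond_pmf (\<pi> k) {y. fst y = z}" if z: "z \<in> set_pmf p" for z
    proof -
      have "map_pmf (\<lambda>x. (x 0, x k)) (D z) = map_pmf (\<lambda>x. (z, x k)) (D z)"
        by (intro map_pmf_cong) (auto simp: D_eq)
      also have "\<dots> = map_pmf (Pair z) (map_pmf (\<lambda>x. x k) (D z))"
        by (simp add: map_pmf_comp)
      also have "\<dots> = map_pmf (\<lambda>y. (z, snd y)) (cond_pmf (\<pi> k) {y. fst y = z})"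
        unfolding D_def using k by (subst Pi_pmf_component) (auto simp: map_pmf_comp)
      \<comment> \<open>Under the conditional law the first component is \<open>z\<close>, so
        \<open>(z, snd y)\<close> is \<open>y\<close> itself.\<close>
      also have "\<dots> = map_pmf id (cond_pmf (\<pi> k) {y. fst y = z})"
        by (intro map_pmf_cong) (auto simp: set_cond_pmf[OF nonempty[OF z]])
      finally show ?thesis
        by simp
    qed
    then have "map_pmf (\<lambda>x. (x 0, x k)) q = bind_pmf p (\<lambda>z. cond_pmf (\<pi> k) {y. fst y = z})"
      unfolding q_def map_bind_pmf by (intro bind_pmf_cong) auto
    \<comment> \<open>Total probability: mixing the conditional laws over the law \<open>p\<close>
      of the first component restores \<open>\<pi> k\<close>.\<close>
    also have "\<dots> = \<pi> k"
    proof (rule bind_cond_pmf_cancel)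
      show "set_pmf p \<inter> {z. fst y = z} \<noteq> {}" if "y \<in> set_pmf (\<pi> k)" for y
        using that unfolding assms[OF k, symmetric] by auto
      show "measure (\<pi> k) {y. fst y = z} = measure p {z. fst y = z}" if "fst y = z" for z y
      proof -
        have "measure p {z} = measure (\<pi> k) (fst -` {z})"
          unfolding assms[OF k, symmetric] by simp
        then show ?thesis
          using that by (simp add: vimage_def)
      qed
    qed (rule nonempty)
    finally show ?thesis .
  qed
  moreover have "set_pmf q \<subseteq> extensional {0..K}"
    using D_ext by (auto simp: q_def)
  moreover have "map_pmf (\<lambda>x. x 0) q = p"
    unfolding q_def map_bind_pmf D_0 by (rule bind_return_pmf')
  ultimately show thesis
    by (intro that)
qed

section \<open>Attained entropic costs\<close>

lemma min_over_eqI: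
  assumes "x \<in> S" "\<And>y. y \<in> S \<Longrightarrow> f x \<le> f y"
  shows "min_over S f = f x"
  unfolding min_over_def using assms by (intro Least_equality) auto

text \<open>On \<open>ereal\<close>, \<open>\<infinity> + -\<infinity>\<close> is
  \<open>\<infinity>\<close>, so a summand \<open>-\<infinity>\<close> decides the sum only once
  \<open>\<infinity>\<close> is excluded elsewhere.\<close>

lemma sum_eq_MInfty:
  fixes f :: "'a \<Rightarrow> ereal"
  assumes "finite A" "\<And>x. x \<in> A \<Longrightarrow> f x \<noteq> \<infinity>" "x \<in> A" "f x = -\<infinity>"
  shows "sum f A = -\<infinity>"
proof -
  have "sum f A = f x + sum f (A - {x})"
    using assms by (intro sum.remove) auto
  moreover have "sum f (A - {x}) \<noteq> \<infinity>"
    using assms by (auto simp: sum_Pinfty)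
  ultimately show ?thesis
    using assms(4) by simp
qed

text \<open>\<open>couplings\<close> imposes no support condition, but the marginals confine every
  coupling to \<open>Z \<times> Z\<close>.\<close>

lemma couplings_eq_marginal_pmfs:
  assumes "set_pmf p1 \<subseteq> Z" "set_pmf p2 \<subseteq> Z"
  shows "couplings p1 p2 = marginal_pmfs (Z \<times> Z) {(fst, p1), (snd, p2)}"
  using assms by (fastforce simp: couplings_def marginal_pmfs_def)

text \<open>The product coupling shows that there are couplings at all; compactness then supplies an
  optimal one, which identifies the value of \<open>min_over\<close>.\<close>

lemma entropic_cost_attained:
  assumes "finite Z" "set_pmf p1 \<subseteq> Z" "set_pmf p2 \<subseteq> Z"
  obtains \<pi> where "\<pi> \<in> couplings p1 p2"
    "entropic_cost Z c \<epsilon> p1 p2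
      = (\<Sum>y\<in>Z \<times> Z. c (fst y) (snd y) * pmf \<pi> y) - \<epsilon> * shannon_entropy \<pi>"
proof -
  have "pair_pmf p1 p2 \<in> couplings p1 p2"
    by (simp add: couplings_def map_fst_pair_pmf map_snd_pair_pmf)
  then have "marginal_pmfs (Z \<times> Z) {(fst, p1), (snd, p2)} \<noteq> {}"
    unfolding couplings_eq_marginal_pmfs[OF assms(2,3)] by auto
  from marginal_pmfs_attains_min[OF _ this, of "\<lambda>y. c (fst y) (snd y)" \<epsilon>] assms(1)
  obtain \<pi> where \<pi>: "\<pi> \<in> couplings p1 p2"
    "\<And>\<pi>'. \<pi>' \<in> couplings p1 p2 \<Longrightarrow>
      (\<Sum>y\<in>Z \<times> Z. c (fst y) (snd y) * pmf \<pi> y) - \<epsilon> * shannon_entropy \<pi>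
      \<le> (\<Sum>y\<in>Z \<times> Z. c (fst y) (snd y) * pmf \<pi>' y) - \<epsilon> * shannon_entropy \<pi>'"
    unfolding couplings_eq_marginal_pmfs[OF assms(2,3)] by blast
  have "entropic_cost Z c \<epsilon> p1 p2 = min_over (couplings p1 p2)
      (\<lambda>\<pi>. (\<Sum>y\<in>Z \<times> Z. c (fst y) (snd y) * pmf \<pi> y) - \<epsilon> * shannon_entropy \<pi>)"
    by (simp add: entropic_cost_def sum.cartesian_product case_prod_unfold)
  also have "\<dots> = (\<Sum>y\<in>Z \<times> Z. c (fst y) (snd y) * pmf \<pi> y) - \<epsilon> * shannon_entropy \<pi>"
    using \<pi> by (rule min_over_eqI)
  finally show thesis
    using \<pi>(1) by (rule that[rotated])
qed

section \<open>Couplings of several marginals\<close>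

lemma multi_couplings_eq_marginal_pmfs:
  "multi_couplings Z K qs = marginal_pmfs (tuples Z K) ((\<lambda>k. (\<lambda>x. x k, qs k)) ` {0..K})"
  by (simp add: multi_couplings_def marginal_pmfs_def)

lemma finite_tuples: "finite Z \<Longrightarrow> finite (tuples Z K)"
  unfolding tuples_def by (intro finite_PiE) auto

lemma multi_couplings_memD:
  assumes "q \<in> multi_couplings Z K qs"
  shows "set_pmf q \<subseteq> tuples Z K"
    and "k \<le> K \<Longrightarrow> map_pmf (\<lambda>x. x k) q = qs k"
  using assms by (simp_all add: multi_couplings_def)

lemma multi_couplings_component:
  assumes "q \<in> multi_couplings Z K qs" "k \<le> K" "x \<in> set_pmf q"
  shows "x k \<in> set_pmf (qs k)"
  unfolding multi_couplings_memD(2)[OF assms(1,2), symmetric] using assms(3) by simp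

text \<open>The \<open>k\<close>-th marginal of the glued law is the second marginal of
  \<open>\<pi> k\<close>, with index 0 handled separately. The marginals place coordinates in
  \<open>Z\<close>, and extensionality completes membership in \<open>tuples Z K\<close>.\<close>

lemma glue_multi_coupling:
  assumes "\<And>k. k \<in> {0..K} \<Longrightarrow> set_pmf (qs k) \<subseteq> Z"
    and "\<And>k. k \<in> {1..K} \<Longrightarrow> \<pi> k \<in> couplings (qs 0) (qs k)"
  obtains q where "q \<in> multi_couplings Z K qs"
    "\<And>k. k \<in> {1..K} \<Longrightarrow> map_pmf (\<lambda>x. (x 0, x k)) q = \<pi> k"
proof -
  have "map_pmf fst (\<pi> k) = qs 0" if "k \<in> {1..K}" for k
    using assms(2)[OF that] by (simp add: couplings_def)
  from glue_couplings[of K \<pi> "qs 0", OF this]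
  obtain q where q: "set_pmf q \<subseteq> extensional {0..K}" "map_pmf (\<lambda>x. x 0) q = qs 0"
    "\<And>k. k \<in> {1..K} \<Longrightarrow> map_pmf (\<lambda>x. (x 0, x k)) q = \<pi> k"
    by blast
  have marginal: "map_pmf (\<lambda>x. x k) q = qs k" if "k \<in> {0..K}" for k
  proof (cases "k = 0")
    case False
    with that have "map_pmf snd (map_pmf (\<lambda>x. (x 0, x k)) q) = qs k"
      using q(3)[of k] assms(2)[of k] by (auto simp: couplings_def)
    then show ?thesis
      by (simp add: map_pmf_comp)
  qed (use q(2) in simp)
  have "x k \<in> Z" if "x \<in> set_pmf q" "k \<in> {0..K}" for x k
    using assms(1)[OF that(2)] imageI[OF that(1), of "\<lambda>x. x k"]
    unfolding marginal[OF that(2), symmetric] by auto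
  then have "set_pmf q \<subseteq> tuples Z K"
    using q(1) by (auto simp: tuples_def PiE_def)
  with marginal q(3) show thesis
    by (intro that[of q]) (auto simp: multi_couplings_def)
qed

section \<open>The joint density and the negative ELBO\<close>

lemma local_norm_pos:
  assumes "finite Z" "Z \<noteq> {}"
  shows "0 < local_norm Z c \<zeta> z"
  unfolding local_norm_def using assms by (intro sum_pos) auto

lemma prior_norm_pos:
  assumes "finite Z" "Z \<noteq> {}"
  shows "0 < prior_norm Z c \<zeta> K"
  unfolding prior_norm_def using assms by (intro sum_pos prod_pos local_norm_pos) auto

text \<open>The normalising constants \<open>C\<^sub>k(z)\<close> of the kernels cancel against the prior.\<close>
lemma joint_eq:
  assumes "finite Z" "Z \<noteq> {}"
  shows "joint Z c \<zeta> K lik x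
    = (\<Prod>k=1..K. exp (- \<zeta> k * c (x k) (x 0)) * lik k (x k)) / prior_norm Z c \<zeta> K"
proof -
  have "(\<Prod>k=1..K. local_norm Z c (\<zeta> k) (x 0)) \<noteq> 0"
    using local_norm_pos[OF assms] by (auto simp: less_le)
  then show ?thesis
    by (simp add: joint_def prior_def local_prob_def prod.distrib prod_dividef)
qed

lemma joint_pos:
  assumes "finite Z" "Z \<noteq> {}" "\<And>k. k \<in> {1..K} \<Longrightarrow> 0 < lik k (x k)"
  shows "0 < joint Z c \<zeta> K lik x"
  unfolding joint_eq[OF assms(1,2)]
  using assms by (intro divide_pos_pos prod_pos prior_norm_pos) auto

lemma ln_joint:
  assumes "finite Z" "Z \<noteq> {}" "\<And>k. k \<in> {1..K} \<Longrightarrow> 0 < lik k (x k)"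
  shows "ln (joint Z c \<zeta> K lik x)
    = (\<Sum>k=1..K. ln (lik k (x k))) - (\<Sum>k=1..K. \<zeta> k * c (x k) (x 0)) - ln (prior_norm Z c \<zeta> K)"
proof -
  have "0 < (\<Prod>k=1..K. exp (- \<zeta> k * c (x k) (x 0)) * lik k (x k))"
    using assms by (intro prod_pos) auto
  moreover have "ln (\<Prod>k=1..K. exp (- \<zeta> k * c (x k) (x 0)) * lik k (x k))
      = (\<Sum>k=1..K. ln (exp (- \<zeta> k * c (x k) (x 0)) * lik k (x k)))"
    using assms(3) by (intro ln_prod) (auto simp: less_le)
  moreover have "\<dots> = (\<Sum>k=1..K. ln (lik k (x k)) - \<zeta> k * c (x k) (x 0))"
    using assms(3) by (intro sum.cong) (auto simp: ln_mult_pos)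
  ultimately show ?thesis
    unfolding joint_eq[OF assms(1,2)]
    using prior_norm_pos[OF assms(1,2)] by (simp add: ln_divide_pos sum_subtractf)
qed

text \<open>Off the support the weight 0 annihilates even infinite values of \<open>f\<close>, so
  \<open>f\<close> has to be real only on the support.\<close>

lemma expect_on_eq_ereal:
  assumes "\<And>x. x \<in> set_pmf q \<Longrightarrow> f x = ereal (g x)"
  shows "expect_on A q f = ereal (\<Sum>x\<in>A. g x * pmf q x)"
proof -
  have "ereal (pmf q x) * f x = ereal (g x * pmf q x)" for x
    using assms by (cases "x \<in> set_pmf q") (auto simp: set_pmf_iff simp flip: zero_ereal_def)
  then show ?thesis
    by (simp add: expect_on_def)
qed

text \<open>Some \<open>x\<close> in the support of \<open>q\<close> has \<open>x k = z\<close>, and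
  the joint density vanishes there. This gives one infinite summand, which decides an
  \<open>ereal\<close> sum.\<close>

lemma neg_elbo_eq_PInfty:
  assumes "finite Z" "q \<in> multi_couplings Z K qs"
    and "k \<in> {1..K}" "z \<in> set_pmf (qs k)" "lik k z = 0"
  shows "neg_elbo Z c \<zeta> K lik q = \<infinity>"
proof -
  note q = multi_couplings_memD[OF assms(2)]
  have "z \<in> set_pmf (map_pmf (\<lambda>x. x k) q)"
    using q(2) assms(3,4) by simp
  then obtain x where x: "x \<in> set_pmf q" "z = x k"
    by auto
  have "(\<Prod>k=1..K. local_prob Z c (\<zeta> k) (x k) (x 0) * lik k (x k)) = 0"
    using x assms(3,5) by (intro prod_zero) auto
  then have "ereal (pmf q x) * - elog (joint Z c \<zeta> K lik x) = \<infinity>"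
    using pmf_positive[OF x(1)] by (simp add: joint_def elog_def)
  then have "expect_on (tuples Z K) q (\<lambda>x. - elog (joint Z c \<zeta> K lik x)) = \<infinity>"
    using x q(1) finite_tuples[OF assms(1)] unfolding expect_on_def sum_Pinfty by blast
  then show ?thesis
    by (simp add: neg_elbo_def)
qed

text \<open>Every tuple in the support of \<open>q\<close> has positive likelihoods, so
  \<open>elog\<close> agrees with \<open>ln\<close> there; elsewhere the weight is 0.\<close>

lemma neg_elbo_eq_ereal:
  assumes "finite Z" "Z \<noteq> {}" "q \<in> multi_couplings Z K qs"
    and "\<And>k z. k \<in> {1..K} \<Longrightarrow> z \<in> set_pmf (qs k) \<Longrightarrow> 0 < lik k z"
  shows "neg_elbo Z c \<zeta> K lik q
    = ereal ((\<Sum>x\<in>tuples Z K. - ln (joint Z c \<zeta> K lik x) * pmf q x) - shannon_entropy q)"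
proof -
  have elog: "- elog (joint Z c \<zeta> K lik x) = ereal (- ln (joint Z c \<zeta> K lik x))"
    if x: "x \<in> set_pmf q" for x
  proof -
    have "x k \<in> set_pmf (qs k)" if "k \<in> {1..K}" for k
      using multi_couplings_component[OF assms(3) _ x] that by simp
    then have "0 < joint Z c \<zeta> K lik x"
      using assms(1,2) by (intro joint_pos assms(4))
    then show ?thesis
      by (simp add: elog_def)
  qed
  have "expect_on (tuples Z K) q (\<lambda>x. - elog (joint Z c \<zeta> K lik x))
      = ereal (\<Sum>x\<in>tuples Z K. - ln (joint Z c \<zeta> K lik x) * pmf q x)"
    using elog by (rule expect_on_eq_ereal)
  then show ?thesis
    by (simp add: neg_elbo_def)
qed

text \<open>Gluing product couplings yields some coupling. If a likelihood vanishes at a point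
  charged by its marginal, the objective is constantly \<open>\<infinity>\<close> and this coupling
  is minimal; otherwise it is real and compactness applies.\<close>

lemma neg_elbo_attains_min:
  assumes "finite Z" "\<And>k. k \<in> {0..K} \<Longrightarrow> set_pmf (qs k) \<subseteq> Z"
    and "\<And>k z. k \<in> {1..K} \<Longrightarrow> z \<in> Z \<Longrightarrow> 0 \<le> lik k z"
  obtains q where "q \<in> multi_couplings Z K qs"
    "\<And>q'. q' \<in> multi_couplings Z K qs \<Longrightarrow> neg_elbo Z c \<zeta> K lik q \<le> neg_elbo Z c \<zeta> K lik q'"
proof -
  have ne: "Z \<noteq> {}"
    using assms(2)[of 0] set_pmf_not_empty[of "qs 0"] by auto
  have "pair_pmf (qs 0) (qs k) \<in> couplings (qs 0) (qs k)" for k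
    by (simp add: couplings_def map_fst_pair_pmf map_snd_pair_pmf)
  from glue_multi_coupling[of K qs Z "\<lambda>k. pair_pmf (qs 0) (qs k)", OF assms(2) this]
  obtain q0 where q0: "q0 \<in> multi_couplings Z K qs"
    by blast
  show thesis
  proof (cases "\<exists>k\<in>{1..K}. \<exists>z\<in>set_pmf (qs k). lik k z = 0")
    case True
    then obtain k z where kz: "k \<in> {1..K}" "z \<in> set_pmf (qs k)" "lik k z = 0"
      by blast
    have "neg_elbo Z c \<zeta> K lik q = \<infinity>" if "q \<in> multi_couplings Z K qs" for q
      using assms(1) that kz by (rule neg_elbo_eq_PInfty)
    then show thesis
      using q0 by (intro that[of q0]) simp_all
  next
    case False
    have pos: "0 < lik k z" if "k \<in> {1..K}" "z \<in> set_pmf (qs k)" for k z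
    proof -
      have "0 \<le> lik k z"
        using that assms(2)[of k] by (intro assms(3)) auto
      moreover have "lik k z \<noteq> 0"
        using that False by blast
      ultimately show ?thesis
        by simp
    qed
    \<comment> \<open>The factor \<open>1\<close> puts the objective into the form of
      \<open>marginal_pmfs_attains_min\<close> with \<open>\<epsilon> = 1\<close>.\<close>
    have eq: "neg_elbo Z c \<zeta> K lik q
        = ereal ((\<Sum>x\<in>tuples Z K. - ln (joint Z c \<zeta> K lik x) * pmf q x) - 1 * shannon_entropy q)"
      if "q \<in> multi_couplings Z K qs" for q
      unfolding mult_1 using assms(1) ne that pos by (rule neg_elbo_eq_ereal)
    have "marginal_pmfs (tuples Z K) ((\<lambda>k. (\<lambda>x. x k, qs k)) ` {0..K}) \<noteq> {}"
      using q0 unfolding multi_couplings_eq_marginal_pmfs by auto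
    from marginal_pmfs_attains_min[OF finite_tuples[OF assms(1)] this,
        of "\<lambda>x. - ln (joint Z c \<zeta> K lik x)" 1]
    obtain q where "q \<in> multi_couplings Z K qs"
      "\<And>q'. q' \<in> multi_couplings Z K qs \<Longrightarrow>
        (\<Sum>x\<in>tuples Z K. - ln (joint Z c \<zeta> K lik x) * pmf q x) - 1 * shannon_entropy q
        \<le> (\<Sum>x\<in>tuples Z K. - ln (joint Z c \<zeta> K lik x) * pmf q' x) - 1 * shannon_entropy q'"
      unfolding multi_couplings_eq_marginal_pmfs by blast
    then show thesis
      by (intro that[of q]) (simp_all only: eq ereal_less_eq)
  qed
qed

section \<open>Upper bound for a glued coupling\<close>

text \<open>The expected negative log density splits exactly into pairwise costs and
  single-coordinate log-likelihoods. The only inequality comes from replacing the entropy of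
  \<open>q\<close> by the average entropy of the \<open>\<pi> k\<close>.\<close>

lemma neg_elbo_le_sum_costs:
  assumes "finite Z" "Z \<noteq> {}" "0 < K" and q: "q \<in> multi_couplings Z K qs"
    and sub: "\<And>k. k \<in> {0..K} \<Longrightarrow> set_pmf (qs k) \<subseteq> Z"
    and \<pi>: "\<And>k. k \<in> {1..K} \<Longrightarrow> map_pmf (\<lambda>x. (x 0, x k)) q = \<pi> k"
    and \<zeta>: "\<And>k. k \<in> {1..K} \<Longrightarrow> 0 < \<zeta> k"
    and lik: "\<And>k z. k \<in> {1..K} \<Longrightarrow> z \<in> set_pmf (qs k) \<Longrightarrow> 0 < lik k z"
    and c_sym: "\<And>y z. c y z = c z y"
  shows "neg_elbo Z c \<zeta> K lik q \<le> ereal (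
    (\<Sum>k=1..K. \<zeta> k * ((\<Sum>y\<in>Z \<times> Z. c (fst y) (snd y) * pmf (\<pi> k) y)
        - 1 / (real K * \<zeta> k) * shannon_entropy (\<pi> k)))
    - (\<Sum>k=1..K. \<Sum>z\<in>Z. ln (lik k z) * pmf (qs k) z) + ln (prior_norm Z c \<zeta> K))"
proof -
  note memD = multi_couplings_memD[OF q]
  let ?T = "tuples Z K"
  have T: "finite ?T"
    using assms(1) by (rule finite_tuples)
  have cost: "(\<Sum>x\<in>?T. c (x 0) (x k) * pmf q x) = (\<Sum>y\<in>Z \<times> Z. c (fst y) (snd y) * pmf (\<pi> k) y)"
    if k: "k \<in> {1..K}" for k
  proof -
    have "x j \<in> Z" if "x \<in> set_pmf q" "j \<le> K" for x j
    proof -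
      have "x j \<in> set_pmf (qs j)"
        using q that(2,1) by (rule multi_couplings_component)
      moreover have "set_pmf (qs j) \<subseteq> Z"
        using that(2) by (intro sub) simp
      ultimately show ?thesis
        by blast
    qed
    then have "set_pmf (map_pmf (\<lambda>x. (x 0, x k)) q) \<subseteq> Z \<times> Z"
      using k by auto
    from sum_pmf_map_pmf[OF T _ memD(1) this, of "\<lambda>y. c (fst y) (snd y)"] assms(1)
    show ?thesis
      unfolding \<pi>[OF k] by simp
  qed
  have lik_sum: "(\<Sum>x\<in>?T. ln (lik k (x k)) * pmf q x) = (\<Sum>z\<in>Z. ln (lik k z) * pmf (qs k) z)"
    if k: "k \<in> {1..K}" for k
  proof -
    have marginal: "map_pmf (\<lambda>x. x k) q = qs k"
      using memD(2) k by simp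
    then have "set_pmf (map_pmf (\<lambda>x. x k) q) \<subseteq> Z"
      using sub[of k] k by (simp del: set_map_pmf)
    from sum_pmf_map_pmf[OF T assms(1) memD(1) this, of "\<lambda>z. ln (lik k z)"]
    show ?thesis
      unfolding marginal by simp
  qed
  \<comment> \<open>Symmetry of \<open>c\<close> turns the kernel's \<open>c (x k) (x 0)\<close>
    into the argument order of the transport cost. The logarithm is expanded on the support only;
    elsewhere both sides are 0.\<close>
  have "(\<Sum>x\<in>?T. - ln (joint Z c \<zeta> K lik x) * pmf q x)
      = (\<Sum>x\<in>?T. (ln (prior_norm Z c \<zeta> K) + (\<Sum>k=1..K. \<zeta> k * c (x 0) (x k))
          - (\<Sum>k=1..K. ln (lik k (x k)))) * pmf q x)"
  proof (intro sum.cong refl)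
    fix x
    show "- ln (joint Z c \<zeta> K lik x) * pmf q x
      = (ln (prior_norm Z c \<zeta> K) + (\<Sum>k=1..K. \<zeta> k * c (x 0) (x k))
          - (\<Sum>k=1..K. ln (lik k (x k)))) * pmf q x"
    proof (cases "x \<in> set_pmf q")
      case True
      have "x k \<in> set_pmf (qs k)" if "k \<in> {1..K}" for k
        using multi_couplings_component[OF q _ True] that by simp
      then have "ln (joint Z c \<zeta> K lik x) = (\<Sum>k=1..K. ln (lik k (x k)))
          - (\<Sum>k=1..K. \<zeta> k * c (x k) (x 0)) - ln (prior_norm Z c \<zeta> K)"
        using assms(1,2) by (intro ln_joint lik)
      then show ?thesis
        by (simp add: c_sym[of _ "x 0"])
    qed (simp add: set_pmf_iff)
  qed
  also have "\<dots> = (\<Sum>x\<in>?T. ln (prior_norm Z c \<zeta> K) * pmf q x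
      + (\<Sum>k=1..K. \<zeta> k * (c (x 0) (x k) * pmf q x)) - (\<Sum>k=1..K. ln (lik k (x k)) * pmf q x))"
    unfolding left_diff_distrib distrib_right sum_distrib_right mult.assoc ..
  also have "\<dots> = ln (prior_norm Z c \<zeta> K) * (\<Sum>x\<in>?T. pmf q x)
      + (\<Sum>k=1..K. \<zeta> k * (\<Sum>x\<in>?T. c (x 0) (x k) * pmf q x))
      - (\<Sum>k=1..K. \<Sum>x\<in>?T. ln (lik k (x k)) * pmf q x)"
    unfolding sum_subtractf sum.distrib sum_distrib_left
      sum.swap[of _ "{1..K}" ?T] ..
  also have "\<dots> = ln (prior_norm Z c \<zeta> K)
      + (\<Sum>k=1..K. \<zeta> k * (\<Sum>y\<in>Z \<times> Z. c (fst y) (snd y) * pmf (\<pi> k) y))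
      - (\<Sum>k=1..K. \<Sum>z\<in>Z. ln (lik k z) * pmf (qs k) z)"
    using cost lik_sum sum_pmf_eq_1[OF T memD(1)] by simp
  finally have energy: "(\<Sum>x\<in>?T. - ln (joint Z c \<zeta> K lik x) * pmf q x) = \<dots>" .
  have "shannon_entropy (\<pi> k) \<le> shannon_entropy q" if "k \<in> {1..K}" for k
    using shannon_entropy_map_pmf_le[of q "\<lambda>x. (x 0, x k)"] finite_subset[OF memD(1) T] \<pi>[OF that]
    by simp
  then have "(\<Sum>k=1..K. shannon_entropy (\<pi> k)) \<le> real K * shannon_entropy q"
    using sum_bounded_above[of "{1..K}" "\<lambda>k. shannon_entropy (\<pi> k)"] by simp
  then have "(\<Sum>k=1..K. shannon_entropy (\<pi> k)) / real K \<le> shannon_entropy q"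
    using assms(3) by (simp add: pos_divide_le_eq mult.commute)
  \<comment> \<open>Multiplying by \<open>\<zeta> k\<close> turns the regularization
    \<open>1 / (real K * \<zeta> k)\<close> into the uniform weight \<open>1 / K\<close>, matching
    the average of entropies.\<close>
  moreover have "(\<Sum>k=1..K. \<zeta> k * (C k - 1 / (real K * \<zeta> k) * shannon_entropy (\<pi> k)))
      = (\<Sum>k=1..K. \<zeta> k * C k) - (\<Sum>k=1..K. shannon_entropy (\<pi> k)) / real K" for C
  proof -
    have "\<zeta> k * (C k - 1 / (real K * \<zeta> k) * shannon_entropy (\<pi> k))
        = \<zeta> k * C k - shannon_entropy (\<pi> k) / real K" if "k \<in> {1..K}" for k
      using \<zeta>[OF that] by (simp add: right_diff_distrib)
    then show ?thesis
      by (simp add: sum_subtractf sum_divide_distrib)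
  qed
  moreover have "neg_elbo Z c \<zeta> K lik q
      = ereal ((\<Sum>x\<in>?T. - ln (joint Z c \<zeta> K lik x) * pmf q x) - shannon_entropy q)"
    using assms(1,2) q lik by (rule neg_elbo_eq_ereal)
  ultimately show ?thesis
    unfolding energy by simp
qed

section \<open>The bound on the minimal negative ELBO\<close>

theorem proposition2p1:
  fixes n K :: nat
    and Z :: "nat set set set"
    and c :: "nat set set \<Rightarrow> nat set set \<Rightarrow> real"
    and \<zeta> :: "nat \<Rightarrow> real"
    and lik :: "nat \<Rightarrow> nat set set \<Rightarrow> real"
    and qs :: "nat \<Rightarrow> nat set set pmf"
  assumes "n \<ge> 1" and "K > 1"
    and "Z = item_partitions n"
    and "Metric_space Z c"
    and "\<And>k. k \<in> {1..K} \<Longrightarrow> \<zeta> k > 0"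
    and "\<And>k z. k \<in> {1..K} \<Longrightarrow> z \<in> Z \<Longrightarrow> lik k z \<ge> 0"
    and "\<And>k. k \<in> {0..K} \<Longrightarrow> set_pmf (qs k) \<subseteq> Z"
  shows "prior_norm Z c \<zeta> K > 0
    \<and> (\<exists>q\<in>multi_couplings Z K qs. \<forall>q'\<in>multi_couplings Z K qs.
          neg_elbo Z c \<zeta> K lik q \<le> neg_elbo Z c \<zeta> K lik q')
    \<and> min_over (multi_couplings Z K qs) (neg_elbo Z c \<zeta> K lik)
      \<le> ereal (\<Sum>k=1..K. \<zeta> k * entropic_cost Z c (1 / (real K * \<zeta> k)) (qs 0) (qs k))
        - (\<Sum>k=1..K. expect_on Z (qs k) (\<lambda>z. elog (lik k z)))
        + ereal (prior_norm Z c \<zeta> K)"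
proof -
  have fin: "finite Z"
    unfolding assms(3) item_partitions_def by (rule finitely_many_partition_on) simp
  have ne: "Z \<noteq> {}"
    using assms(7)[of 0] set_pmf_not_empty[of "qs 0"] by auto
  have S: "0 < prior_norm Z c \<zeta> K"
    using fin ne by (rule prior_norm_pos)
  have sym: "c y z = c z y" for y z
    using assms(4) by (rule Metric_space.commute)
  obtain q where q: "q \<in> multi_couplings Z K qs"
    "\<And>q'. q' \<in> multi_couplings Z K qs \<Longrightarrow> neg_elbo Z c \<zeta> K lik q \<le> neg_elbo Z c \<zeta> K lik q'"
    using neg_elbo_attains_min[of Z K qs lik c \<zeta>, OF fin assms(7,6)] by blast
  let ?W = "\<Sum>k=1..K. \<zeta> k * entropic_cost Z c (1 / (real K * \<zeta> k)) (qs 0) (qs k)"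
  let ?E = "\<lambda>k. expect_on Z (qs k) (\<lambda>z. elog (lik k z))"
  have "neg_elbo Z c \<zeta> K lik q \<le> ereal ?W - (\<Sum>k=1..K. ?E k) + ereal (prior_norm Z c \<zeta> K)"
  proof (cases "\<exists>k\<in>{1..K}. \<exists>z\<in>set_pmf (qs k). lik k z = 0")
    case True
    then obtain k z where kz: "k \<in> {1..K}" "z \<in> set_pmf (qs k)" "lik k z = 0"
      by auto
    \<comment> \<open>\<open>elog\<close> never takes the value \<open>\<infinity>\<close>, so the
      expected log-likelihoods cannot mix infinities of both signs; their sum is
      \<open>-\<infinity>\<close> and the right-hand side \<open>\<infinity>\<close>.\<close>
    have summand: "ereal (pmf (qs j) y) * elog (lik j y) \<noteq> \<infinity>" for j y
      by (auto simp: elog_def ereal_mult_eq_PInfty)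
    have "ereal (pmf (qs k) z) * elog (lik k z) = -\<infinity>"
      using kz(3) pmf_positive[OF kz(2)] by (simp add: elog_def)
    then have "?E k = -\<infinity>"
      unfolding expect_on_def using kz assms(7)[of k] fin summand by (intro sum_eq_MInfty[of _ _ z]) auto
    moreover have "?E j \<noteq> \<infinity>" for j
      unfolding expect_on_def using summand by (auto simp: sum_Pinfty)
    ultimately have "(\<Sum>k=1..K. ?E k) = -\<infinity>"
      using kz(1) by (intro sum_eq_MInfty[of _ _ k]) auto
    then show ?thesis
      by simp
  next
    case False
    have lik: "0 < lik k z" if "k \<in> {1..K}" "z \<in> set_pmf (qs k)" for k z
    proof -
      have "0 \<le> lik k z"
        using that assms(7)[of k] by (intro assms(6)) auto
      moreover have "lik k z \<noteq> 0"
        using that False by blast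
      ultimately show ?thesis
        by simp
    qed
    have "\<forall>k\<in>{1..K}. \<exists>\<pi>. \<pi> \<in> couplings (qs 0) (qs k) \<and>
        entropic_cost Z c (1 / (real K * \<zeta> k)) (qs 0) (qs k)
        = (\<Sum>y\<in>Z \<times> Z. c (fst y) (snd y) * pmf \<pi> y) - 1 / (real K * \<zeta> k) * shannon_entropy \<pi>"
    proof
      fix k
      assume "k \<in> {1..K}"
      then have "set_pmf (qs 0) \<subseteq> Z" "set_pmf (qs k) \<subseteq> Z"
        using assms(7) by auto
      then obtain \<pi> where "\<pi> \<in> couplings (qs 0) (qs k)"
        "entropic_cost Z c (1 / (real K * \<zeta> k)) (qs 0) (qs k)
          = (\<Sum>y\<in>Z \<times> Z. c (fst y) (snd y) * pmf \<pi> y) - 1 / (real K * \<zeta> k) * shannon_entropy \<pi>"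
        by (rule entropic_cost_attained[OF fin])
      then show "\<exists>\<pi>. \<pi> \<in> couplings (qs 0) (qs k) \<and>
        entropic_cost Z c (1 / (real K * \<zeta> k)) (qs 0) (qs k)
        = (\<Sum>y\<in>Z \<times> Z. c (fst y) (snd y) * pmf \<pi> y) - 1 / (real K * \<zeta> k) * shannon_entropy \<pi>"
        by (intro exI conjI)
    qed
    from bchoice[OF this]
    obtain \<pi> where \<pi>: "\<And>k. k \<in> {1..K} \<Longrightarrow> \<pi> k \<in> couplings (qs 0) (qs k)"
      "\<And>k. k \<in> {1..K} \<Longrightarrow> entropic_cost Z c (1 / (real K * \<zeta> k)) (qs 0) (qs k)
        = (\<Sum>y\<in>Z \<times> Z. c (fst y) (snd y) * pmf (\<pi> k) y)
          - 1 / (real K * \<zeta> k) * shannon_entropy (\<pi> k)"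
      by blast
    \<comment> \<open>The glued \<open>q'\<close> may fail to minimise the negative ELBO; it is a
      competitor against the minimiser \<open>q\<close>.\<close>
    obtain q' where q': "q' \<in> multi_couplings Z K qs"
      "\<And>k. k \<in> {1..K} \<Longrightarrow> map_pmf (\<lambda>x. (x 0, x k)) q' = \<pi> k"
      using glue_multi_coupling[of K qs Z \<pi>, OF assms(7) \<pi>(1)] by blast
    have "elog (lik k z) = ereal (ln (lik k z))" if "k \<in> {1..K}" "z \<in> set_pmf (qs k)" for k z
      using lik[OF that] by (simp add: elog_def)
    then have E: "?E k = ereal (\<Sum>z\<in>Z. ln (lik k z) * pmf (qs k) z)" if "k \<in> {1..K}" for k
      using that by (intro expect_on_eq_ereal) auto
    have "neg_elbo Z c \<zeta> K lik q \<le> neg_elbo Z c \<zeta> K lik q'"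
      using q'(1) by (rule q(2))
    also have "\<dots> \<le> ereal (?W - (\<Sum>k=1..K. \<Sum>z\<in>Z. ln (lik k z) * pmf (qs k) z)
        + ln (prior_norm Z c \<zeta> K))"
      using neg_elbo_le_sum_costs[where \<pi> = \<pi>, OF fin ne _ q'(1) assms(7) q'(2) assms(5) lik sym]
        assms(2) \<pi>(2) by simp
    \<comment> \<open>The estimate so far has the constant \<open>ln S\<close> with
      \<open>S = prior_norm Z c \<zeta> K\<close>; \<open>ln S \<le> S\<close> relaxes it to the
      stated one.\<close>
    also have "\<dots> \<le> ereal (?W - (\<Sum>k=1..K. \<Sum>z\<in>Z. ln (lik k z) * pmf (qs k) z)
        + prior_norm Z c \<zeta> K)"
      using ln_bound[OF S] by simp
    also have "\<dots> = ereal ?W - (\<Sum>k=1..K. ?E k) + ereal (prior_norm Z c \<zeta> K)"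
      using E by simp
    finally show ?thesis .
  qed
  moreover have "min_over (multi_couplings Z K qs) (neg_elbo Z c \<zeta> K lik) = neg_elbo Z c \<zeta> K lik q"
    using q by (rule min_over_eqI)
  ultimately show ?thesis
    using S by (intro conjI bexI[of _ q] ballI q) simp_all
qed

end
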